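(* There is an algorithm which, given $n$, computes $s(n)$, the number of tournament sequences of length $n$, with naive bit complexity $O(n^6)$.
   Context: A tournament sequence of length $n$ is a sequence of positive integers $(t_1,\ldots,t_n)$ with $t_1=1$ and $t_i<t_{i+1}\leq 2t_i$ for $1\leq i<n$. In the naive bit complexity model, computing $a+b$ costs time $O(\log a+\log b)$ and computing $ab$ costs time $O(\log a\log b)$ (the cost of the grade-school algorithms). *)

theory Defs
  imports "HOL-Library.Landau_Symbols" "HOL-Library.Log_Nat"
begin

definition tournament_sequence :: "nat list \<Rightarrow> bool" where
  "tournament_sequence ts \<longleftrightarrow>
     ts \<noteq> [] \<and> (\<forall>t \<in> set ts. 0 < t) \<and> ts ! 0 = 1 \<and>
     (\<forall>i. Suc i < length ts \<longrightarrow> ts ! i < ts ! Suc i \<and> ts ! Suc i \<le> 2 * ts ! i)"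

definition num_tournament_sequences :: "nat \<Rightarrow> nat" where
  "num_tournament_sequences n = card {ts. tournament_sequence ts \<and> length ts = n}"

text \<open>
  Algorithms are programs of a structured language over unbounded integers, with
  scalar variables and integer-indexed arrays. Costs are those of the logarithmic-cost random
  access machine, with the grade-school cost for multiplication: every operation is charged,
  including copying, memory access (which also pays for the length of the address) and tests.
\<close>

type_synonym vname = string

record state =
  vars :: "vname \<Rightarrow> int"
  arrs :: "vname \<Rightarrow> int \<Rightarrow> int"

datatype aexp =
    Const int
  | Var vname
  | Elem vname aexp
  | Add aexp aexp
  | Sub aexp aexp
  | Mul aexp aexp

datatype bexp =
    Less aexp aexp
  | Neg bexp
  | And bexp bexp

datatype com =
    Skip
  | Assign vname aexp
  | Store vname aexp aexp
  | Seq com com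
  | Cond bexp com com
  | While bexp com

text \<open>The maximum with 1 makes every operation, also on the operand 0, cost at least one unit.\<close>

definition bits :: "int \<Rightarrow> nat" where
  "bits x = max 1 (nat (bitlen \<bar>x\<bar>))"

fun aval :: "aexp \<Rightarrow> state \<Rightarrow> int" where
  "aval (Const k) s = k"
| "aval (Var x) s = vars s x"
| "aval (Elem a i) s = arrs s a (aval i s)"
| "aval (Add e f) s = aval e s + aval f s"
| "aval (Sub e f) s = aval e s - aval f s"
| "aval (Mul e f) s = aval e s * aval f s"

fun acost :: "aexp \<Rightarrow> state \<Rightarrow> nat" where
  "acost (Const k) s = bits k"
| "acost (Var x) s = bits (vars s x)"
| "acost (Elem a i) s = acost i s + bits (aval i s) + bits (arrs s a (aval i s))"
| "acost (Add e f) s = acost e s + acost f s + (bits (aval e s) + bits (aval f s))"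
| "acost (Sub e f) s = acost e s + acost f s + (bits (aval e s) + bits (aval f s))"
| "acost (Mul e f) s = acost e s + acost f s + bits (aval e s) * bits (aval f s)"

fun bval :: "bexp \<Rightarrow> state \<Rightarrow> bool" where
  "bval (Less e f) s \<longleftrightarrow> aval e s < aval f s"
| "bval (Neg b) s \<longleftrightarrow> \<not> bval b s"
| "bval (And b c) s \<longleftrightarrow> bval b s \<and> bval c s"

fun bcost :: "bexp \<Rightarrow> state \<Rightarrow> nat" where
  "bcost (Less e f) s = acost e s + acost f s + (bits (aval e s) + bits (aval f s))"
| "bcost (Neg b) s = bcost b s + 1"
| "bcost (And b c) s = bcost b s + bcost c s + 1"

text \<open>\<open>exec c s t k\<close>: started in \<open>s\<close>, program \<open>c\<close> terminates in \<open>t\<close> at total cost \<open>k\<close>.\<close>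

inductive exec :: "com \<Rightarrow> state \<Rightarrow> state \<Rightarrow> nat \<Rightarrow> bool" where
  Skip: "exec Skip s s 1"
| Assign: "exec (Assign x e) s (s\<lparr>vars := (vars s)(x := aval e s)\<rparr>)
     (acost e s + bits (aval e s))"
| Store: "exec (Store a i e) s
     (s\<lparr>arrs := (arrs s)(a := (arrs s a)(aval i s := aval e s))\<rparr>)
     (acost i s + acost e s + bits (aval i s) + bits (aval e s))"
| Seq: "exec c s t k \<Longrightarrow> exec d t u l \<Longrightarrow> exec (Seq c d) s u (k + l)"
| CondTrue: "bval b s \<Longrightarrow> exec c s t k \<Longrightarrow> exec (Cond b c d) s t (bcost b s + k)"
| CondFalse: "\<not> bval b s \<Longrightarrow> exec d s t k \<Longrightarrow> exec (Cond b c d) s t (bcost b s + k)"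
| WhileFalse: "\<not> bval b s \<Longrightarrow> exec (While b c) s s (bcost b s)"
| WhileTrue: "bval b s \<Longrightarrow> exec c s t k \<Longrightarrow> exec (While b c) t u l \<Longrightarrow>
     exec (While b c) s u (bcost b s + k + l)"

inductive_cases Skip_E: "exec Skip s t k"
  and Assign_E: "exec (Assign x e) s t k"
  and Store_E: "exec (Store a i e) s t k"
  and Seq_E: "exec (Seq c d) s t k"
  and Cond_E: "exec (Cond b c d) s t k"
  and While_E: "exec (While b c) s t k"

lemma exec_deterministic:
  "exec c s t k \<Longrightarrow> exec c s t' k' \<Longrightarrow> t' = t \<and> k' = k"
proof (induction arbitrary: t' k' rule: exec.induct)
  case Seq
  from Seq.prems show ?case by (rule Seq_E) (use Seq.IH in blast)
next
  case CondTrue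
  from CondTrue.prems show ?case by (rule Cond_E) (use CondTrue.hyps CondTrue.IH in blast)+
next
  case CondFalse
  from CondFalse.prems show ?case by (rule Cond_E) (use CondFalse.hyps CondFalse.IH in blast)+
next
  case WhileFalse
  from WhileFalse.prems show ?case by (rule While_E) (use WhileFalse.hyps in blast)+
next
  case WhileTrue
  from WhileTrue.prems show ?case by (rule While_E) (use WhileTrue.hyps WhileTrue.IH in blast)+
qed (auto elim: Skip_E Assign_E Store_E)

definition input_state :: "nat \<Rightarrow> state" where
  "input_state n = \<lparr>vars = (\<lambda>_. 0)(''n'' := int n), arrs = (\<lambda>_ _. 0)\<rparr>"

definition output_value :: "state \<Rightarrow> int" where
  "output_value s = vars s ''out''"

end

theory Submission
  imports Defs
begin

text \<open>
  Let \<open>f\<^sub>k t\<close> be the number of ways to extend a tournament sequence ending in \<open>t\<close> by \<open>k\<close> terms,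
  so that \<open>f\<^sub>k\<^sub>+\<^sub>1 t = (\<Sum>u\<in>{t<..2 * t}. f\<^sub>k u)\<close> and the answer is \<open>f\<^sub>n\<^sub>-\<^sub>1 1\<close>. Each \<open>f\<^sub>k\<close> is a polynomial
  of degree at most \<open>k\<close>; represent it by its Newton coefficients, the forward differences at 0.
  With the shift \<open>\<sigma>\<close> on coefficient sequences, \<open>t \<mapsto> t + 1\<close> acts as \<open>1 + \<sigma>\<close>, and \<open>t \<mapsto> 2 * t\<close> turns
  the difference operator into \<open>(1 + \<sigma>)\<^sup>2 - 1 = 2 * \<sigma> + \<sigma>\<^sup>2\<close>. Hence one step from \<open>f\<^sub>k\<close> to \<open>f\<^sub>k\<^sub>+\<^sub>1\<close> takes
  \<open>O(n\<^sup>2)\<close> additions and no multiplication. All numbers have \<open>O(n\<^sup>2)\<close> bits, which even gives \<open>O(n\<^sup>5)\<close>.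
\<close>

section \<open>Newton expansions\<close>

text \<open>\<open>newton a t\<close> is \<open>\<Sum>j\<le>t. (t choose j) * a j\<close>; the recursion is all that is needed of it.\<close>

fun newton :: "(nat \<Rightarrow> int) \<Rightarrow> nat \<Rightarrow> int" where
  "newton a 0 = a 0"
| "newton a (Suc t) = newton a t + newton (\<lambda>j. a (Suc j)) t"

text \<open>For \<open>f = newton c\<close>, row 0 holds the coefficients of \<open>t \<mapsto> \<Sum>u\<le>t. f u\<close>, and row \<open>i\<close> arises
  from it by applying \<open>2 * \<sigma> + \<sigma>\<^sup>2\<close> \<open>i\<close> times.\<close>

fun row :: "(nat \<Rightarrow> int) \<Rightarrow> nat \<Rightarrow> nat \<Rightarrow> int" where
  "row c 0 m = (if m = 0 then 0 else c (m - 1)) + c m"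
| "row c (Suc i) m = 2 * row c i (Suc m) + row c i (Suc (Suc m))"

text \<open>Column 0, \<open>row (coef k) j 0\<close>, lists the Newton coefficients of the sum up
  to \<open>2 * t\<close>, row 0 those of the sum up to \<open>t\<close>; their difference belongs
  to the sum over \<open>t < u \<le> 2 * t\<close>.\<close>

fun coef :: "nat \<Rightarrow> nat \<Rightarrow> int" where
  "coef 0 j = (if j = 0 then 1 else 0)"
| "coef (Suc k) j = row (coef k) j 0 - row (coef k) 0 j"

fun num_continuations :: "nat \<Rightarrow> nat \<Rightarrow> nat" where
  "num_continuations 0 t = 1"
| "num_continuations (Suc k) t = (\<Sum>u\<in>{t<..2 * t}. num_continuations k u)"

lemma newton_add: "newton (\<lambda>j. a j + b j) t = newton a t + newton b t"
  by (induction t arbitrary: a b) auto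

lemma newton_diff: "newton (\<lambda>j. a j - b j) t = newton a t - newton b t"
  by (induction t arbitrary: a b) auto

text \<open>Two unit steps of \<open>newton\<close> contribute
  \<open>2 * \<sigma> + \<sigma>\<^sup>2\<close>, which is one step of \<open>row\<close>. So
  raising \<open>t\<close> by one also brings in \<open>Suc i\<close>, and the induction must range
  over all \<open>i\<close>.\<close>

lemma newton_double:
  "newton (\<lambda>j. row c i (m + j)) (2 * t) = newton (\<lambda>p. row c (i + p) m) t"
proof (induction t arbitrary: i m)
  case (Suc t)
  have "newton (\<lambda>j. row c i (m + j)) (2 * Suc t) =
     newton (\<lambda>j. row c i (m + j)) (2 * t) + (newton (\<lambda>j. row c i (m + Suc j)) (2 * t)
       + newton (\<lambda>j. row c i (m + Suc j)) (2 * t) + newton (\<lambda>j. row c i (m + Suc (Suc j))) (2 * t))"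
    by simp
  also have "\<dots> = newton (\<lambda>j. row c i (m + j)) (2 * t) + newton (\<lambda>j. row c (Suc i) (m + j)) (2 * t)"
    by (simp flip: newton_add)
  also have "\<dots> = newton (\<lambda>p. row c (i + p) m) (Suc t)"
    unfolding Suc.IH by simp
  finally show ?case .
qed simp

text \<open>The partial sums start at 0 and have the summand as forward difference, so the
  coefficients move up one place.\<close>

lemma sum_newton:
  "(\<Sum>u<t. newton c u) = newton (\<lambda>j. if j = 0 then 0 else c (j - 1)) t"
  by (induction t) auto

lemma sum_newton_Suc: "(\<Sum>u<Suc t. newton c u) = newton (row c 0) t"
proof -
  have "row c 0 = (\<lambda>j. (if j = 0 then 0 else c (j - 1)) + c j)"
    by auto
  then show ?thesis
    by (simp add: newton_add sum_newton del: row.simps)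
qed

lemma num_continuations_eq_newton: "int (num_continuations k t) = newton (coef k) t"
proof (induction k arbitrary: t)
  case 0
  have "newton (\<lambda>j. 0) t = 0" for t
    by (induction t) auto
  then show ?case
    by (induction t) auto
next
  case (Suc k)
  have coef_Suc: "coef (Suc k) = (\<lambda>j. row (coef k) j 0 - row (coef k) 0 j)"
    by (simp add: fun_eq_iff)
  have split: "{..<Suc (2 * t)} = {..<Suc t} \<union> {t<..2 * t}"
    by auto
  have "(\<Sum>u<Suc (2 * t). newton (coef k) u) =
      (\<Sum>u<Suc t. newton (coef k) u) + (\<Sum>u\<in>{t<..2 * t}. newton (coef k) u)"
    unfolding split by (rule sum.union_disjoint) auto
  then have "(\<Sum>u\<in>{t<..2 * t}. newton (coef k) u) =
      newton (row (coef k) 0) (2 * t) - newton (row (coef k) 0) t"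
    unfolding sum_newton_Suc by simp
  also have "newton (row (coef k) 0) (2 * t) = newton (\<lambda>p. row (coef k) p 0) t"
    using newton_double[of "coef k" 0 0 t] by (simp del: row.simps)
  finally have "(\<Sum>u\<in>{t<..2 * t}. newton (coef k) u) = newton (coef (Suc k)) t"
    by (simp add: coef_Suc newton_diff del: coef.simps row.simps)
  then show ?case
    by (simp add: Suc.IH del: coef.simps)
qed

section \<open>Degree and size of the coefficients\<close>

lemma row_eq_0:
  assumes "\<And>j. k < j \<Longrightarrow> c j = 0" "Suc k < i + m"
  shows "row c i m = 0"
  using assms(2) by (induction i arbitrary: m) (auto simp: assms(1))

text \<open>Row 0 reaches one index further than \<open>coef k\<close>, and every later row is one
  entry shorter. This makes loops over the indices 0 to \<open>n\<close> cover all nonzero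
  cells.\<close>

lemma coef_eq_0: "k < j \<Longrightarrow> coef k j = 0"
proof (induction k arbitrary: j)
  case (Suc k)
  then show ?case
    using row_eq_0[of k "coef k" j 0] row_eq_0[of k "coef k" 0 j] by simp
qed simp

lemma abs_row_le:
  assumes "\<And>j. \<bar>c j\<bar> \<le> A"
  shows "\<bar>row c i m\<bar> \<le> 2 * 3 ^ i * A"
proof (induction i arbitrary: m)
  case 0
  have "0 \<le> A"
    using assms[of 0] by linarith
  then show ?case
    using assms[of "m - 1"] assms[of m] by auto
next
  case (Suc i)
  show ?case
    using Suc.IH[of "Suc m"] Suc.IH[of "Suc (Suc m)"] by simp
qed

text \<open>Row 0 at most doubles the entries and each later row at most triples them. For
  \<open>j \<le> Suc k\<close> a stage thus costs a factor \<open>2 * 3 ^ j + 2\<close>, below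
  \<open>4 ^ (k + 2)\<close>, while the exponent in the claim grows by \<open>2 * (k + 1)\<close>.
  Beyond that \<open>j\<close> the coefficient is 0.\<close>

lemma abs_coef_le: "\<bar>coef k j\<bar> \<le> 4 ^ (k * Suc k)"
proof (induction k arbitrary: j)
  case (Suc k)
  show ?case
  proof (cases "j \<le> Suc k")
    case True
    let ?A = "4 ^ (k * Suc k) :: int"
    have "\<bar>coef (Suc k) j\<bar> \<le> 2 * 3 ^ j * ?A + 2 * 3 ^ 0 * ?A"
      using abs_row_le[of "coef k" ?A j 0] abs_row_le[of "coef k" ?A 0 j] Suc.IH
      by (simp del: row.simps power.simps)
    also have "\<dots> \<le> 4 * 4 ^ Suc k * ?A"
    proof -
      have "(3::int) ^ j \<le> 4 ^ j"
        by (rule power_mono) auto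
      also have "(4::int) ^ j \<le> 4 ^ Suc k"
        using True by (intro power_increasing) auto
      finally have "2 * 3 ^ j + 2 \<le> 4 * (4::int) ^ Suc k"
        using one_le_power[of "4::int" "Suc k"] by linarith
      from mult_right_mono[OF this, of ?A] show ?thesis
        by (simp add: algebra_simps)
    qed
    also have "\<dots> = 4 ^ (Suc (Suc k) + k * Suc k)"
      by (simp only: power_add power_Suc)
    also have "\<dots> \<le> 4 ^ (Suc k * Suc (Suc k))"
      by (intro power_increasing) auto
    finally show ?thesis .
  qed (simp add: coef_eq_0 del: coef.simps)
qed simp

section \<open>Counting tournament sequences\<close>

definition continuations :: "nat \<Rightarrow> nat \<Rightarrow> nat list set" where
  "continuations k t =
     {ts. length ts = k \<and> successively (\<lambda>a b. a < b \<and> b \<le> 2 * a) (t # ts)}"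

lemma continuations_Suc:
  "continuations (Suc k) t = (\<Union>u\<in>{t<..2 * t}. (#) u ` continuations k u)"
  by (auto simp: continuations_def length_Suc_conv)

lemma finite_card_continuations:
  "finite (continuations k t) \<and> card (continuations k t) = num_continuations k t"
proof (induction k arbitrary: t)
  case 0
  have "continuations 0 t = {[]}"
    by (auto simp: continuations_def)
  then show ?case
    by simp
next
  case (Suc k)
  then show ?case
    \<comment> \<open>The sets in the union are disjoint because their lists have different
      heads.\<close>
    unfolding continuations_Suc by (subst card_UN_disjoint) (auto simp: card_image)
qed

text \<open>Positivity comes from the growth condition: every later term lies strictly above its
  predecessor, and the first is 1.\<close>

lemma tournament_sequence_Cons:
  "tournament_sequence (t # ts) \<longleftrightarrow>
     t = 1 \<and> successively (\<lambda>a b. a < b \<and> b \<le> 2 * a) (t # ts)"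
proof -
  let ?P = "\<lambda>a b :: nat. a < b \<and> b \<le> 2 * a"
  have pos: "\<forall>x\<in>set us. 0 < x" if "successively ?P (u # us)" for u us
    using that by (induction us arbitrary: u) auto
  have "tournament_sequence (t # ts) \<longleftrightarrow>
      (\<forall>x\<in>set (t # ts). 0 < x) \<and> t = 1 \<and> successively ?P (t # ts)"
    unfolding tournament_sequence_def successively_conv_nth[of ?P] by simp
  also have "\<dots> \<longleftrightarrow> t = 1 \<and> successively ?P (t # ts)"
    using pos[of t ts] by (cases "successively ?P (t # ts)") auto
  finally show ?thesis .
qed

lemma num_tournament_sequences_Suc:
  "num_tournament_sequences (Suc k) = num_continuations k 1"
proof -
  have "{ts. tournament_sequence ts \<and> length ts = Suc k} = (#) 1 ` continuations k 1"
    by (auto simp: continuations_def length_Suc_conv tournament_sequence_Cons)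
  then show ?thesis
    using finite_card_continuations[of k 1]
    by (simp add: num_tournament_sequences_def card_image)
qed

text \<open>At the argument 1 the Newton expansion consists of its two lowest terms.\<close>

lemma num_tournament_sequences_eq_coef:
  "1 \<le> n \<Longrightarrow> int (num_tournament_sequences n) = coef (n - 1) 0 + coef (n - 1) 1"
  using num_tournament_sequences_Suc[of "n - 1"] num_continuations_eq_newton[of "n - 1" 1]
  by simp

section \<open>Total correctness with cost bounds\<close>

text \<open>A total-correctness judgement in weakest-precondition style: the postcondition may
  itself be a \<open>runs\<close> statement about the next command, and the cost is only bounded
  from above.\<close>

definition runs :: "com \<Rightarrow> state \<Rightarrow> (state \<Rightarrow> bool) \<Rightarrow> nat \<Rightarrow> bool" where
  "runs c s Q K \<longleftrightarrow> (\<exists>t k. exec c s t k \<and> k \<le> K \<and> Q t)"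

lemma runs_weaken: "runs c s Q K \<Longrightarrow> (\<And>t. Q t \<Longrightarrow> Q' t) \<Longrightarrow> K \<le> K' \<Longrightarrow> runs c s Q' K'"
  unfolding runs_def by (meson le_trans)

lemma runs_Seq: "runs c s (\<lambda>t. runs d t Q L) K \<Longrightarrow> runs (Seq c d) s Q (K + L)"
  unfolding runs_def by (meson add_mono exec.Seq)

lemma runs_While:
  assumes step: "\<And>j s. j < N \<Longrightarrow> I j s \<Longrightarrow> bval b s \<and> bcost b s \<le> B \<and> runs c s (I (Suc j)) K"
    and stop: "\<And>s. I N s \<Longrightarrow> \<not> bval b s \<and> bcost b s \<le> B"
    and init: "I 0 s"
  shows "runs (While b c) s (I N) (Suc N * (B + K))"
proof -
  \<comment> \<open>\<open>d\<close> counts the iterations still to come; the extra \<open>B\<close>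
    pays for the final failing test.\<close>
  have "runs (While b c) s (I N) (d * (B + K) + B)" if "d \<le> N" "I (N - d) s" for d s
    using that
  proof (induction d arbitrary: s)
    case 0
    then show ?case
      using stop exec.WhileFalse unfolding runs_def by fastforce
  next
    case (Suc d)
    then have "N - Suc d < N" "Suc (N - Suc d) = N - d"
      by auto
    with step[of "N - Suc d" s] Suc.prems obtain t k where
      "bval b s" "bcost b s \<le> B" "exec c s t k" "k \<le> K" "I (N - d) t"
      unfolding runs_def by auto
    moreover with Suc obtain u l where
      "exec (While b c) t u l" "l \<le> d * (B + K) + B" "I N u"
      unfolding runs_def by (meson Suc_leD)
    ultimately have "exec (While b c) s u (bcost b s + k + l)"
        "bcost b s + k + l \<le> Suc d * (B + K) + B"
      by (auto intro: exec.WhileTrue)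
    with \<open>I N u\<close> show ?case
      unfolding runs_def by blast
  qed
  from this[of N s] init show ?thesis
    by (auto intro: runs_weaken)
qed

text \<open>On states all of whose entries have absolute value at most \<open>V\<close>, the cost of an expression
  without multiplications is bounded by its size times the number of bits of \<open>8 * V\<close>,
  provided that its \<open>gain\<close> is at most 8. The gain 9 of a product rules multiplications out.\<close>

fun gain :: "aexp \<Rightarrow> nat" where
  "gain (Const k) = nat \<bar>k\<bar>"
| "gain (Var x) = 1"
| "gain (Elem a i) = max 1 (gain i)"
| "gain (Add e f) = gain e + gain f"
| "gain (Sub e f) = gain e + gain f"
| "gain (Mul e f) = 9"

fun weight :: "aexp \<Rightarrow> nat" where
  "weight (Const k) = 1"
| "weight (Var x) = 1"
| "weight (Elem a i) = weight i + 2"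
| "weight (Add e f) = weight e + weight f + 2"
| "weight (Sub e f) = weight e + weight f + 2"
| "weight (Mul e f) = 0"

text \<open>The exponent is chosen so that all rows computed from \<open>coef k\<close> with
  \<open>k < n\<close> stay below this bound.\<close>

definition magnitude :: "nat \<Rightarrow> int" where
  "magnitude n = 4 ^ (n * n + 2)"

text \<open>\<open>8 * magnitude n\<close> is 2 to the power \<open>2 * (n * n) + 7\<close>, so it
  has one bit more than that exponent.\<close>

definition width :: "nat \<Rightarrow> nat" where
  "width n = 2 * (n * n) + 8"

definition fits :: "nat \<Rightarrow> state \<Rightarrow> bool" where
  "fits n s \<longleftrightarrow> vars s ''n'' = int n \<and> (\<forall>x. \<bar>vars s x\<bar> \<le> magnitude n) \<and>
     (\<forall>a i. \<bar>arrs s a i\<bar> \<le> magnitude n)"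

text \<open>Ensures that the loop counters, which reach at most \<open>n + 1\<close>, fit as
  well.\<close>

lemma magnitude_ge: "int n + 2 \<le> magnitude n"
proof -
  have "n + 2 < 2 ^ (n + 2)"
    by (rule less_exp)
  also have "(2::nat) ^ (n + 2) \<le> 4 ^ (n + 2)"
    by (rule power_mono) auto
  also have "(4::nat) ^ (n + 2) \<le> 4 ^ (n * n + 2)"
    by (intro power_increasing) auto
  finally have "int (n + 2) \<le> int (4 ^ (n * n + 2))"
    by linarith
  then show ?thesis
    by (simp add: magnitude_def)
qed

lemma bits_le_width:
  assumes "\<bar>x\<bar> \<le> 8 * magnitude n"
  shows "bits x \<le> width n"
proof -
  have "8 * magnitude n = 2 ^ (2 * (n * n) + 7)"
    by (simp add: magnitude_def power_add power_mult)
  also have "\<dots> < 2 ^ width n"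
    by (simp add: width_def)
  finally have "\<bar>x\<bar> < 2 ^ width n"
    using assms by linarith
  then have "bitlen \<bar>x\<bar> \<le> int (width n)"
    by (simp add: bitlen_le_iff_power)
  then show ?thesis
    by (simp add: bits_def nat_le_iff) (simp add: width_def)
qed

lemma abs_aval_le:
  assumes "fits n s" "gain e \<le> 8"
  shows "\<bar>aval e s\<bar> \<le> int (gain e) * magnitude n"
  using assms(2)
proof (induction e)
  case (Const k)
  show ?case
    using mult_left_mono[of 1 "magnitude n" "\<bar>k\<bar>"] magnitude_ge[of n] by simp
next
  case (Elem a i)
  have "magnitude n \<le> int (max 1 (gain i)) * magnitude n"
    using mult_right_mono[of 1 "int (max 1 (gain i))" "magnitude n"] magnitude_ge[of n] by simp
  moreover have "\<bar>aval (Elem a i) s\<bar> \<le> magnitude n"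
    using assms(1) by (simp add: fits_def)
  ultimately show ?case
    by simp
qed (use assms(1) in \<open>auto simp: fits_def algebra_simps\<close>)

lemma bits_aval_le:
  assumes "fits n s" "gain e \<le> 8"
  shows "bits (aval e s) \<le> width n"
proof (rule bits_le_width)
  have "int (gain e) * magnitude n \<le> 8 * magnitude n"
    using assms(2) magnitude_ge[of n] by (intro mult_right_mono) auto
  then show "\<bar>aval e s\<bar> \<le> 8 * magnitude n"
    using abs_aval_le[OF assms] by linarith
qed

lemma acost_le:
  assumes "fits n s" "gain e \<le> 8"
  shows "acost e s \<le> weight e * width n"
  using assms(2)
proof (induction e)
  case (Elem a i)
  then show ?case
    using bits_aval_le[OF assms(1), of i] bits_aval_le[OF assms(1), of "Elem a i"] by auto
next
  case (Add e f)
  then show ?case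
    using bits_aval_le[OF assms(1), of e] bits_aval_le[OF assms(1), of f]
    by (simp add: add_mult_distrib)
next
  case (Sub e f)
  then show ?case
    using bits_aval_le[OF assms(1), of e] bits_aval_le[OF assms(1), of f]
    by (simp add: add_mult_distrib)
qed (use bits_aval_le[OF assms(1), of "Const _"] bits_aval_le[OF assms(1), of "Var _"] in auto)

lemma bcost_Less_le:
  assumes "fits n s" "gain e \<le> 8" "gain f \<le> 8"
  shows "bcost (Less e f) s \<le> (weight e + weight f + 2) * width n"
  using acost_le[OF assms(1,2)] acost_le[OF assms(1,3)]
    bits_aval_le[OF assms(1,2)] bits_aval_le[OF assms(1,3)]
  by (simp add: add_mult_distrib)

lemma runs_Assign:
  assumes "fits n s" "gain e \<le> 8" "Q (s\<lparr>vars := (vars s)(x := aval e s)\<rparr>)"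
  shows "runs (Assign x e) s Q ((weight e + 1) * width n)"
proof -
  have "acost e s + bits (aval e s) \<le> (weight e + 1) * width n"
    using acost_le[OF assms(1,2)] bits_aval_le[OF assms(1,2)] by (simp add: add_mult_distrib)
  then show ?thesis
    using assms(3) exec.Assign[of x e s] unfolding runs_def by blast
qed

lemma runs_Store:
  assumes "fits n s" "gain i \<le> 8" "gain e \<le> 8"
    "Q (s\<lparr>arrs := (arrs s)(a := (arrs s a)(aval i s := aval e s))\<rparr>)"
  shows "runs (Store a i e) s Q ((weight i + weight e + 2) * width n)"
proof -
  have "acost i s + acost e s + bits (aval i s) + bits (aval e s)
      \<le> (weight i + weight e + 2) * width n"
    using acost_le[OF assms(1,2)] acost_le[OF assms(1,3)]
      bits_aval_le[OF assms(1,2)] bits_aval_le[OF assms(1,3)]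
    by (simp add: add_mult_distrib)
  then show ?thesis
    using assms(4) exec.Store[of a i e s] unfolding runs_def by blast
qed

lemma fits_Assign:
  "fits n s \<Longrightarrow> x \<noteq> ''n'' \<Longrightarrow> \<bar>v\<bar> \<le> magnitude n \<Longrightarrow> fits n (s\<lparr>vars := (vars s)(x := v)\<rparr>)"
  by (simp add: fits_def)

lemma fits_Store:
  "fits n s \<Longrightarrow> \<bar>v\<bar> \<le> magnitude n \<Longrightarrow>
     fits n (s\<lparr>arrs := (arrs s)(a := (arrs s a)(i := v))\<rparr>)"
  by (simp add: fits_def)

text \<open>The offset \<open>d\<close> is 1 for loops over the indices 0 to \<open>n\<close> and -1
  for the \<open>n - 1\<close> stages.\<close>

definition For :: "vname \<Rightarrow> int \<Rightarrow> com \<Rightarrow> com" where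
  "For x d c = Seq (Assign x (Const 0))
     (While (Less (Var x) (Add (Var ''n'') (Const d)))
       (Seq c (Assign x (Add (Var x) (Const 1)))))"

text \<open>The rule tracks the counter itself: \<open>I\<close> must not depend on
  \<open>x\<close>, and the body must leave \<open>x\<close> as it found it.\<close>

lemma runs_For:
  assumes s: "fits n s" "I 0 s"
    and x: "x \<noteq> ''n''"
    and N: "int N = int n + d" "\<bar>d\<bar> \<le> 1"
    and indep: "\<And>j s v. I j s \<Longrightarrow> I j (s\<lparr>vars := (vars s)(x := v)\<rparr>)"
    and body: "\<And>j s. j < N \<Longrightarrow> fits n s \<Longrightarrow> vars s x = int j \<Longrightarrow> I j s \<Longrightarrow>
      runs c s (\<lambda>t. fits n t \<and> vars t x = int j \<and> I (Suc j) t) K"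
  shows "runs (For x d c) s (\<lambda>t. fits n t \<and> I N t) ((n + 3) * (14 * width n + K))"
proof -
  let ?J = "\<lambda>j s. fits n s \<and> vars s x = int j \<and> I j s"
  let ?b = "Less (Var x) (Add (Var ''n'') (Const d))"
  have bcost: "bcost ?b s \<le> 7 * width n" if "fits n s" for s
  proof -
    have "gain (Var x) \<le> 8" "gain (Add (Var ''n'') (Const d)) \<le> 8"
      using N(2) by auto
    from bcost_Less_le[OF that this] show ?thesis
      by (simp del: bcost.simps)
  qed
  have step: "runs (Seq c (Assign x (Add (Var x) (Const 1)))) s (?J (Suc j)) (K + 5 * width n)"
    if j: "j < N" and J: "?J j s" for j s
  proof (rule runs_Seq, rule runs_weaken[OF body[OF j]])
    fix t
    assume t: "fits n t \<and> vars t x = int j \<and> I (Suc j) t"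
    have "\<bar>int j + 1\<bar> \<le> magnitude n"
      using j N magnitude_ge[of n] by linarith
    then have "?J (Suc j) (t\<lparr>vars := (vars t)(x := aval (Add (Var x) (Const 1)) t)\<rparr>)"
      using t x by (auto intro!: fits_Assign indep)
    with t have "runs (Assign x (Add (Var x) (Const 1))) t (?J (Suc j))
        ((weight (Add (Var x) (Const 1)) + 1) * width n)"
      by (intro runs_Assign) auto
    then show "runs (Assign x (Add (Var x) (Const 1))) t (?J (Suc j)) (5 * width n)"
      by (rule runs_weaken) auto
  qed (use J in auto)
  have "runs (While ?b (Seq c (Assign x (Add (Var x) (Const 1))))) s (?J N)
      (Suc N * (7 * width n + (K + 5 * width n)))" if "?J 0 s" for s
    using that
  proof (rule runs_While[rotated 2])
    show "bval ?b s \<and> bcost ?b s \<le> 7 * width n \<and>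
        runs (Seq c (Assign x (Add (Var x) (Const 1)))) s (?J (Suc j)) (K + 5 * width n)"
      if "j < N" "?J j s" for j s
    proof (intro conjI)
      show "bval ?b s"
        using that N by (simp add: fits_def)
    qed (use step[OF that] bcost that in \<open>auto simp del: bcost.simps\<close>)
    show "\<not> bval ?b s \<and> bcost ?b s \<le> 7 * width n" if "?J N s" for s
    proof (intro conjI)
      show "\<not> bval ?b s"
        using that N by (simp add: fits_def)
    qed (use bcost that in \<open>auto simp del: bcost.simps\<close>)
  qed
  moreover have "?J 0 (s\<lparr>vars := (vars s)(x := aval (Const 0) s)\<rparr>)"
    using s x magnitude_ge[of n] by (auto intro!: fits_Assign indep)
  ultimately have "runs (For x d c) s (?J N)
      ((weight (Const 0) + 1) * width n + Suc N * (7 * width n + (K + 5 * width n)))"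
    unfolding For_def using s by (intro runs_Seq runs_Assign) auto
  then show ?thesis
  proof (rule runs_weaken)
    \<comment> \<open>Per round, 7 widths pay for the test and 5 for the increment; the 2 for the
      initialisation are absorbed in passing from \<open>n + 2\<close> to
      \<open>n + 3\<close>.\<close>
    have "Suc N * (12 * width n + K) \<le> (n + 2) * (12 * width n + K)"
      using N by (intro mult_right_mono) auto
    then show "(weight (Const 0) + 1) * width n + Suc N * (7 * width n + (K + 5 * width n))
        \<le> (n + 3) * (14 * width n + K)"
      by (simp add: algebra_simps)
  qed auto
qed

section \<open>The program\<close>

text \<open>At index \<open>m = 0\<close> this reads the cell \<open>c[-1]\<close>, which is never written and holds 0.\<close>

definition fill_body :: com where
  "fill_body = (let e = Add (Elem ''c'' (Sub (Var ''m'') (Const 1))) (Elem ''c'' (Var ''m'')) in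
     Seq (Store ''r'' (Var ''m'') e) (Store ''e'' (Var ''m'') e))"

text \<open>Updating in place is safe for ascending \<open>m\<close>, since only the cells
  \<open>m + 1\<close> and \<open>m + 2\<close>, still old, are read. Doubling is done by
  addition.\<close>

definition shift_body :: com where
  "shift_body = Store ''r'' (Var ''m'')
     (Add (Add (Elem ''r'' (Add (Var ''m'') (Const 1))) (Elem ''r'' (Add (Var ''m'') (Const 1))))
       (Elem ''r'' (Add (Var ''m'') (Const 2))))"

text \<open>\<open>''r''\<close> holds the current row and \<open>''e''\<close> keeps row 0. The old
  \<open>''c''\<close> may be overwritten, since within a stage it is read only while row 0 is
  filled.\<close>

definition row_body :: com where
  "row_body = Seq (Store ''c'' (Var ''i'') (Sub (Elem ''r'' (Const 0)) (Elem ''e'' (Var ''i''))))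
     (For ''m'' 1 shift_body)"

definition stage_body :: com where
  "stage_body = Seq (For ''m'' 1 fill_body) (For ''i'' 1 row_body)"

definition program :: com where
  "program = Seq (Store ''c'' (Const 0) (Const 1))
     (Seq (For ''k'' (-1) stage_body)
       (Assign ''out'' (Add (Elem ''c'' (Const 0)) (Elem ''c'' (Const 1)))))"

section \<open>Bounds on the stored values and loop invariants\<close>

lemma abs_coef_le_magnitude:
  assumes "k < n"
  shows "2 * \<bar>coef k j\<bar> \<le> magnitude n"
proof -
  have "\<bar>coef k j\<bar> \<le> 4 ^ (k * Suc k)"
    by (rule abs_coef_le)
  also have "\<dots> \<le> 4 ^ (n * n)"
    using assms by (intro power_increasing mult_le_mono) auto
  finally show ?thesis
    by (simp add: magnitude_def)
qed

lemma abs_row_le_magnitude: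
  assumes "k < n" "i \<le> Suc n"
  shows "\<bar>row (coef k) i m\<bar> \<le> magnitude n"
proof -
  have "\<bar>row (coef k) i m\<bar> \<le> 2 * 3 ^ i * 4 ^ (k * Suc k)"
    by (rule abs_row_le) (rule abs_coef_le)
  also have "\<dots> \<le> 4 * 4 ^ Suc n * 4 ^ (k * Suc k)"
  proof (intro mult_right_mono mult_mono)
    have "(3::int) ^ i \<le> 4 ^ i"
      by (rule power_mono) auto
    also have "(4::int) ^ i \<le> 4 ^ Suc n"
      using assms by (intro power_increasing) auto
    finally show "(3::int) ^ i \<le> 4 ^ Suc n" .
  qed auto
  also have "\<dots> = 4 ^ (n + 2 + k * Suc k)"
    by (simp add: power_add)
  also have "\<dots> \<le> 4 ^ (n * n + 2)"
  proof (rule power_increasing)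
    \<comment> \<open>From \<open>Suc k \<le> n\<close> follows
      \<open>k * Suc k \<le> (n - 1) * n\<close>, with equality for
      \<open>k = n - 1\<close>.\<close>
    obtain d where "n = Suc (k + d)"
      using assms(1) less_imp_Suc_add by blast
    then show "n + 2 + k * Suc k \<le> n * n + 2"
      by (simp add: algebra_simps)
  qed simp
  finally show ?thesis
    by (simp add: magnitude_def)
qed

declare row.simps [simp del] coef.simps [simp del]

lemma runs_shift:
  assumes s: "fits n s" "\<And>j. arrs s ''r'' (int j) = row (coef k) i j" and k: "k < n" "i \<le> n"
  shows "runs (For ''m'' 1 shift_body) s
    (\<lambda>t. fits n t \<and> (\<forall>j. arrs t ''r'' (int j) = row (coef k) (Suc i) j) \<and>
       (\<forall>a. a \<noteq> ''r'' \<longrightarrow> arrs t a = arrs s a) \<and> (\<forall>x. x \<noteq> ''m'' \<longrightarrow> vars t x = vars s x))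
    ((n + 3) * (40 * width n))"
proof -
  \<comment> \<open>Cells below \<open>m\<close> already hold row \<open>Suc i\<close>, all others
    still row \<open>i\<close>.\<close>
  define I where "I = (\<lambda>m (t :: state).
       (\<forall>j. arrs t ''r'' (int j) = row (coef k) (if j < m then Suc i else i) j) \<and>
       (\<forall>a. a \<noteq> ''r'' \<longrightarrow> arrs t a = arrs s a) \<and> (\<forall>x. x \<noteq> ''m'' \<longrightarrow> vars t x = vars s x))"
  have "runs (For ''m'' 1 shift_body) s (\<lambda>t. fits n t \<and> I (n + 1) t)
      ((n + 3) * (14 * width n + 25 * width n))"
  proof (rule runs_For)
    fix m t
    assume m: "m < n + 1" and t: "fits n t" "vars t ''m'' = int m" "I m t"
    let ?e = "Add (Add (Elem ''r'' (Add (Var ''m'') (Const 1))) (Elem ''r'' (Add (Var ''m'') (Const 1))))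
       (Elem ''r'' (Add (Var ''m'') (Const 2)))"
    have r: "arrs t ''r'' (int j) = row (coef k) (if j < m then Suc i else i) j" for j
      using t(3) by (simp add: I_def)
    have "aval ?e t = row (coef k) (Suc i) m"
      using r[of "Suc m"] r[of "Suc (Suc m)"] t(2) by (simp add: row.simps add.commute)
    moreover have "\<bar>row (coef k) (Suc i) m\<bar> \<le> magnitude n"
      using k by (intro abs_row_le_magnitude) auto
    ultimately show "runs shift_body t
       (\<lambda>t. fits n t \<and> vars t ''m'' = int m \<and> I (Suc m) t) (25 * width n)"
      unfolding shift_body_def
      by (intro runs_weaken[OF runs_Store[where Q = "\<lambda>t. fits n t \<and> vars t ''m'' = int m \<and> I (Suc m) t"]])
        (use t in \<open>auto simp del: aval.simps(4) simp: I_def intro!: fits_Store\<close>)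
  qed (use s in \<open>auto simp: I_def\<close>)
  then show ?thesis
  proof (rule runs_weaken)
    fix t
    assume "fits n t \<and> I (n + 1) t"
    \<comment> \<open>Past index \<open>n\<close> both rows vanish, so the unwritten cells are
      correct too.\<close>
    moreover have "row (coef k) (if j < n + 1 then Suc i else i) j = row (coef k) (Suc i) j" for j
      using row_eq_0[of k "coef k" i j] row_eq_0[of k "coef k" "Suc i" j] coef_eq_0 k by auto
    ultimately show "fits n t \<and> (\<forall>j. arrs t ''r'' (int j) = row (coef k) (Suc i) j) \<and>
       (\<forall>a. a \<noteq> ''r'' \<longrightarrow> arrs t a = arrs s a) \<and> (\<forall>x. x \<noteq> ''m'' \<longrightarrow> vars t x = vars s x)"
      unfolding I_def by metis
  qed simp
qed

text \<open>The loop stops at index \<open>n\<close>, beyond which row 0 vanishes; hence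
  \<open>''r''\<close> must be 0 there beforehand. \<open>''e''\<close> is only read up to
  \<open>n\<close>.\<close>

lemma runs_fill:
  assumes s: "fits n s" "\<And>j. arrs s ''c'' (int j) = coef k j" "arrs s ''c'' (-1) = 0"
    "\<And>j. n < j \<Longrightarrow> arrs s ''r'' (int j) = 0" and k: "k < n"
  shows "runs (For ''m'' 1 fill_body) s
    (\<lambda>t. fits n t \<and> (\<forall>j. arrs t ''r'' (int j) = row (coef k) 0 j) \<and>
       (\<forall>j\<le>n. arrs t ''e'' (int j) = row (coef k) 0 j) \<and>
       arrs t ''c'' = arrs s ''c'' \<and> (\<forall>x. x \<noteq> ''m'' \<longrightarrow> vars t x = vars s x))
    ((n + 3) * (50 * width n))"
proof -
  define I where "I = (\<lambda>m (t :: state).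
       (\<forall>j. (j < m \<longrightarrow> arrs t ''r'' (int j) = row (coef k) 0 j \<and> arrs t ''e'' (int j) = row (coef k) 0 j)
         \<and> (n < j \<longrightarrow> arrs t ''r'' (int j) = 0)) \<and>
       arrs t ''c'' = arrs s ''c'' \<and> (\<forall>x. x \<noteq> ''m'' \<longrightarrow> vars t x = vars s x))"
  have "runs (For ''m'' 1 fill_body) s (\<lambda>t. fits n t \<and> I (n + 1) t)
      ((n + 3) * (14 * width n + 28 * width n))"
  proof (rule runs_For)
    fix m t
    assume m: "m < n + 1" and t: "fits n t" "vars t ''m'' = int m" "I m t"
    let ?e = "Add (Elem ''c'' (Sub (Var ''m'') (Const 1))) (Elem ''c'' (Var ''m''))"
    have e: "aval ?e u = row (coef k) 0 m" if "vars u ''m'' = int m" "arrs u ''c'' = arrs s ''c''" for u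
      using s(2)[of "m - 1"] s(2)[of m] s(3) that by (cases m) (simp_all add: row.simps)
    have b: "\<bar>row (coef k) 0 m\<bar> \<le> magnitude n"
      using k by (intro abs_row_le_magnitude) auto
    let ?Q = "\<lambda>t. fits n t \<and> vars t ''m'' = int m \<and> I (Suc m) t"
    let ?t = "t\<lparr>arrs := (arrs t)(''r'' := (arrs t ''r'')(int m := row (coef k) 0 m))\<rparr>"
    let ?u = "?t\<lparr>arrs := (arrs ?t)(''e'' := (arrs ?t ''e'')(int m := row (coef k) 0 m))\<rparr>"
    \<comment> \<open>The expression is evaluated again after the store to \<open>''r''\<close>; it
      reads only \<open>''c''\<close> and \<open>''m''\<close>, so its value is the same.\<close>
    have et: "aval ?e t = row (coef k) 0 m" "aval ?e ?t = row (coef k) 0 m"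
      using t by (intro e; simp add: I_def)+
    have ft: "fits n ?t"
      using t b by (intro fits_Store) auto
    then have "fits n ?u"
      using b by (rule fits_Store)
    then have "?Q ?u"
      using t m by (auto simp: I_def less_Suc_eq)
    then have e: "runs (Store ''e'' (Var ''m'') ?e) ?t ?Q ((weight (Var ''m'') + weight ?e + 2) * width n)"
      using t ft et by (intro runs_Store) (simp_all del: aval.simps(4))
    have "runs (Store ''r'' (Var ''m'') ?e) t (\<lambda>t. runs (Store ''e'' (Var ''m'') ?e) t ?Q
        ((weight (Var ''m'') + weight ?e + 2) * width n)) ((weight (Var ''m'') + weight ?e + 2) * width n)"
      by (rule runs_Store) (use t et e in \<open>simp_all del: aval.simps(4) weight.simps\<close>)
    from runs_Seq[OF this] show "runs fill_body t ?Q (28 * width n)"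
      unfolding fill_body_def Let_def by (rule runs_weaken) auto
  qed (use s in \<open>auto simp: I_def\<close>)
  then show ?thesis
  proof (rule runs_weaken)
    fix t
    assume t: "fits n t \<and> I (n + 1) t"
    then have "arrs t ''r'' (int j) = row (coef k) 0 j" for j
      using row_eq_0[of k "coef k" 0 j] coef_eq_0 k by (cases "j \<le> n") (auto simp: I_def)
    with t show "fits n t \<and> (\<forall>j. arrs t ''r'' (int j) = row (coef k) 0 j) \<and>
       (\<forall>j\<le>n. arrs t ''e'' (int j) = row (coef k) 0 j) \<and>
       arrs t ''c'' = arrs s ''c'' \<and> (\<forall>x. x \<noteq> ''m'' \<longrightarrow> vars t x = vars s x)"
      by (auto simp: I_def)
  qed simp
qed

lemma runs_rows:
  assumes s: "fits n s" "\<And>j. arrs s ''r'' (int j) = row (coef k) 0 j"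
    "\<And>j. j \<le> n \<Longrightarrow> arrs s ''e'' (int j) = row (coef k) 0 j"
    "\<And>j. arrs s ''c'' (int j) = coef k j" "arrs s ''c'' (-1) = 0" and k: "Suc k < n"
  shows "runs (For ''i'' 1 row_body) s
    (\<lambda>t. fits n t \<and> (\<forall>j. arrs t ''c'' (int j) = coef (Suc k) j) \<and> arrs t ''c'' (-1) = 0 \<and>
       (\<forall>j>n. arrs t ''r'' (int j) = 0) \<and> vars t ''k'' = vars s ''k'')
    ((n + 3) * ((n + 3) * (70 * width n)))"
proof -
  define I where "I = (\<lambda>i (t :: state). (\<forall>j. arrs t ''r'' (int j) = row (coef k) i j) \<and>
       (\<forall>j\<le>n. arrs t ''e'' (int j) = row (coef k) 0 j) \<and>
       (\<forall>j. arrs t ''c'' (int j) = coef (if j < i then Suc k else k) j) \<and> arrs t ''c'' (-1) = 0 \<and>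
       vars t ''k'' = vars s ''k'')"
  have "runs (For ''i'' 1 row_body) s (\<lambda>t. fits n t \<and> I (n + 1) t)
      ((n + 3) * (14 * width n + (11 * width n + (n + 3) * (40 * width n))))"
  proof (rule runs_For)
    fix i t
    assume i: "i < n + 1" and t: "fits n t" "vars t ''i'' = int i" "I i t"
    let ?e = "Sub (Elem ''r'' (Const 0)) (Elem ''e'' (Var ''i''))"
    let ?Q = "\<lambda>t. fits n t \<and> vars t ''i'' = int i \<and> I (Suc i) t"
    let ?t = "t\<lparr>arrs := (arrs t)(''c'' := (arrs t ''c'')(int i := coef (Suc k) i))\<rparr>"
    have r: "arrs t ''r'' (int j) = row (coef k) i j" for j
      using t(3) by (simp add: I_def)
    have e: "aval ?e t = coef (Suc k) i"
      using t i r[of 0] by (simp add: I_def coef.simps)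
    have "fits n ?t"
      using t abs_coef_le_magnitude[OF k, of i] by (intro fits_Store) auto
    then have "runs (For ''m'' 1 shift_body) ?t
       (\<lambda>u. fits n u \<and> (\<forall>j. arrs u ''r'' (int j) = row (coef k) (Suc i) j) \<and>
          (\<forall>a. a \<noteq> ''r'' \<longrightarrow> arrs u a = arrs ?t a) \<and> (\<forall>x. x \<noteq> ''m'' \<longrightarrow> vars u x = vars ?t x))
       ((n + 3) * (40 * width n))"
      using r k i by (intro runs_shift) auto
    then have "runs (For ''m'' 1 shift_body) ?t ?Q ((n + 3) * (40 * width n))"
      by (rule runs_weaken) (use t in \<open>auto simp: I_def\<close>)
    then have "runs (Store ''c'' (Var ''i'') ?e) t
        (\<lambda>t. runs (For ''m'' 1 shift_body) t ?Q ((n + 3) * (40 * width n)))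
        ((weight (Var ''i'') + weight ?e + 2) * width n)"
      using t e by (intro runs_Store) (simp_all del: aval.simps(5))
    from runs_Seq[OF this]
    show "runs row_body t ?Q (11 * width n + (n + 3) * (40 * width n))"
      unfolding row_body_def by (rule runs_weaken) auto
  qed (use s in \<open>auto simp: I_def\<close>)
  then show ?thesis
  proof (rule runs_weaken)
    fix t
    assume t: "fits n t \<and> I (n + 1) t"
    have "coef (if j < n + 1 then Suc k else k) j = coef (Suc k) j" for j
      using coef_eq_0 k by auto
    \<comment> \<open>The last row is identically 0, which restores the precondition on
      \<open>''r''\<close> for filling in the next stage.\<close>
    moreover have "row (coef k) (n + 1) j = 0" for j
      using k coef_eq_0 by (intro row_eq_0[of k]) auto
    ultimately show "fits n t \<and> (\<forall>j. arrs t ''c'' (int j) = coef (Suc k) j) \<and> arrs t ''c'' (-1) = 0 \<and>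
       (\<forall>j>n. arrs t ''r'' (int j) = 0) \<and> vars t ''k'' = vars s ''k''"
      using t unfolding I_def by metis
  next
    have "25 * width n \<le> (n + 3) * (30 * width n)"
      by (simp add: algebra_simps)
    then show "(n + 3) * (14 * width n + (11 * width n + (n + 3) * (40 * width n)))
        \<le> (n + 3) * ((n + 3) * (70 * width n))"
      by (intro mult_left_mono) (auto simp: algebra_simps)
  qed
qed

lemma runs_program:
  assumes n: "1 \<le> n"
  shows "runs program (input_state n)
    (\<lambda>t. output_value t = int (num_tournament_sequences n)) ((n + 3) ^ 3 * (200 * width n))"
proof -
  define I where "I = (\<lambda>k (t :: state). (\<forall>j. arrs t ''c'' (int j) = coef k j) \<and> arrs t ''c'' (-1) = 0 \<and>
       (\<forall>j>n. arrs t ''r'' (int j) = 0))"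
  let ?Q = "\<lambda>t. output_value t = int (num_tournament_sequences n)"
  let ?S = "(n + 3) * (50 * width n) + (n + 3) * ((n + 3) * (70 * width n))"
  let ?s = "input_state n"
  let ?t = "?s\<lparr>arrs := (arrs ?s)(''c'' := (arrs ?s ''c'')(0 := 1))\<rparr>"
  let ?e = "Add (Elem ''c'' (Const 0)) (Elem ''c'' (Const 1))"
  have fs: "fits n ?s"
    using magnitude_ge[of n] by (auto simp: fits_def input_state_def)
  then have ft: "fits n ?t"
    using magnitude_ge[of n] by (intro fits_Store) auto
  have "runs (For ''k'' (-1) stage_body) ?t (\<lambda>t. fits n t \<and> I (n - 1) t)
      ((n + 3) * (14 * width n + ?S))"
  proof (rule runs_For)
    fix k t
    assume k: "k < n - 1" and t: "fits n t" "vars t ''k'' = int k" "I k t"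
    show "runs stage_body t (\<lambda>t. fits n t \<and> vars t ''k'' = int k \<and> I (Suc k) t) ?S"
      unfolding stage_body_def
    proof (rule runs_Seq, rule runs_weaken[OF runs_fill])
      fix u
      assume u: "fits n u \<and> (\<forall>j. arrs u ''r'' (int j) = row (coef k) 0 j) \<and>
       (\<forall>j\<le>n. arrs u ''e'' (int j) = row (coef k) 0 j) \<and>
       arrs u ''c'' = arrs t ''c'' \<and> (\<forall>x. x \<noteq> ''m'' \<longrightarrow> vars u x = vars t x)"
      show "runs (For ''i'' 1 row_body) u (\<lambda>t. fits n t \<and> vars t ''k'' = int k \<and> I (Suc k) t)
          ((n + 3) * ((n + 3) * (70 * width n)))"
        by (rule runs_weaken[OF runs_rows[of n u k]]) (use u t k in \<open>auto simp: I_def\<close>)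
    qed (use t k in \<open>auto simp: I_def\<close>)
  qed (use ft n in \<open>auto simp: I_def input_state_def coef.simps\<close>)
  then have "runs (For ''k'' (-1) stage_body) ?t
      (\<lambda>t. runs (Assign ''out'' ?e) t ?Q ((weight ?e + 1) * width n)) ((n + 3) * (14 * width n + ?S))"
  proof (rule runs_weaken)
    fix u
    assume u: "fits n u \<and> I (n - 1) u"
    then have "aval ?e u = coef (n - 1) 0 + coef (n - 1) 1"
      unfolding I_def by (metis aval.simps(1,3,4) of_nat_0 of_nat_1)
    with u show "runs (Assign ''out'' ?e) u ?Q ((weight ?e + 1) * width n)"
      by (intro runs_Assign)
        (simp_all del: aval.simps(4) add: output_value_def num_tournament_sequences_eq_coef[OF n])
  qed simp
  from runs_Seq[OF this] have "runs (Store ''c'' (Const 0) (Const 1)) ?s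
      (\<lambda>t. runs (Seq (For ''k'' (-1) stage_body) (Assign ''out'' ?e)) t ?Q
        ((n + 3) * (14 * width n + ?S) + (weight ?e + 1) * width n))
      ((weight (Const 0) + weight (Const 1) + 2) * width n)"
    using fs by (intro runs_Store) auto
  from runs_Seq[OF this] show ?thesis
    unfolding program_def
  proof (rule runs_weaken)
    show "(weight (Const 0) + weight (Const 1) + 2) * width n
        + ((n + 3) * (14 * width n + ?S) + (weight ?e + 1) * width n) \<le> (n + 3) ^ 3 * (200 * width n)"
      by (simp add: algebra_simps power3_eq_cube)
  qed
qed

theorem theorem1:
  "\<exists>(c :: com) (T :: nat \<Rightarrow> nat).
     (\<forall>n\<ge>1. \<exists>t. exec c (input_state n) t (T n) \<and> output_value t = int (num_tournament_sequences n)) \<and>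
     (\<lambda>n. real (T n)) \<in> O(\<lambda>n. real n ^ 6)"
proof -
  \<comment> \<open>\<open>runs\<close> only bounds the cost, so \<open>T n\<close> is chosen as the
    actual cost for \<open>n \<ge> 1\<close>; \<open>T 0\<close> is arbitrary.\<close>
  have "\<forall>n. \<exists>k. 1 \<le> n \<longrightarrow> (\<exists>t. exec program (input_state n) t k \<and>
      output_value t = int (num_tournament_sequences n)) \<and> k \<le> (n + 3) ^ 3 * (200 * width n)"
    using runs_program unfolding runs_def by meson
  then obtain T where T: "\<And>n. 1 \<le> n \<Longrightarrow> \<exists>t. exec program (input_state n) t (T n) \<and>
      output_value t = int (num_tournament_sequences n)"
    "\<And>n. 1 \<le> n \<Longrightarrow> T n \<le> (n + 3) ^ 3 * (200 * width n)"
    by metis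
  have bound: "T n \<le> 128000 * n ^ 6" if n: "1 \<le> n" for n
  proof -
    have sq: "1 \<le> n * n"
      using n by simp
    have "T n \<le> (n + 3) ^ 3 * (200 * width n)"
      using T(2) n .
    \<comment> \<open>For \<open>n \<ge> 1\<close>, \<open>n + 3 \<le> 4 * n\<close> and
      \<open>width n \<le> 10 * (n * n)\<close>; the constant is 64 * 200 * 10.\<close>
    also have "\<dots> \<le> (4 * n) ^ 3 * (200 * (10 * (n * n)))"
      using n sq by (intro mult_mono power_mono) (auto simp: width_def)
    also have "\<dots> = 128000 * n ^ 5"
      by (simp add: power_mult_distrib flip: power2_eq_square power_add)
    also have "\<dots> \<le> 128000 * n ^ 6"
      using n by (intro mult_left_mono power_increasing) auto
    finally show ?thesis .
  qed
  have "real (T n) \<le> 128000 * real n ^ 6" if "1 \<le> n" for n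
    using of_nat_mono[OF bound[OF that], where ?'a = real] by simp
  then have "(\<lambda>n. real (T n)) \<in> O(\<lambda>n. real n ^ 6)"
    by (intro bigoI[of _ 128000] eventually_sequentiallyI[of 1]) simp
  with T(1) show ?thesis
    by blast
qed

end
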